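(* Consider the ESQL algorithm (described in the context) run with $K$ environments and constant update ratio $u_t=u\in(0,1)$. Let $\mathbf{Q}^{it}_t$ be its output $Q$-table, $\mathbf{Q}^{(n)}_t$ the $Q$-table of the $n$-th environment and $\mathbf{w}^{(n)}_t$ the weight of the $n$-th environment at time $t$. Let $$\Delta^{it}_t(s,a)=\mathbf{Q}^{it}_{t+1}(s,a)-\mathbf{Q}^{it}_t(s,a),$$ and let $\epsilon^{(n)}_t(s,a)$ be the weighted $Q$-function update of the $n$-th environment for $(s,a)$ from time $t$ to $t+1$: $$\epsilon^{(n)}_t(s,a)=\mathbf{w}^{(n)}_{t+1}\mathbf{Q}^{(n)}_{t+1}(s,a)-\mathbf{w}^{(n)}_t\mathbf{Q}^{(n)}_t(s,a).$$ Moreover, let $\theta^{(n)}(s,a)$ be the smallest positive constant that satisfies $|\epsilon^{(n)}_t(s,a)|\le\theta^{(n)}(s,a)$ for all $t$, $n$, $(s,a)$. Then, for all $(s,a)\in\mathcal{S}\times\mathcal{A}$, $$\lim_{t\to\infty}|\Delta^{it}_t(s,a)|\le\sum_{n=1}^K\theta^{(n)}(s,a).$$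
   Context: ESQL (Ensemble Synthetic $Q$-Learning) runs in parallel $K$ $Q$-learning algorithms on $K$ finite Markov decision processes $\mathcal{M}^{(1)},\dots,\mathcal{M}^{(K)}$ sharing the same finite state space $\mathcal{S}$, finite action space $\mathcal{A}$, cost function $c_a(s)$ and discount factor $\gamma\in(0,1)$; $\mathcal{M}^{(1)}$ is the original environment and the others are synthetic environments built from it. $\mathbf{Q}^{(n)}_t\in\mathbb{R}^{|\mathcal{S}|\times|\mathcal{A}|}$ is the $Q$-table of the $n$-th environment at time $t$, updated from samples $(s,a,s',c)$ of $\mathcal{M}^{(n)}$ by the $Q$-learning rule $Q(s,a)\leftarrow(1-\alpha)Q(s,a)+\alpha\bigl(c_a(s)+\gamma\min_{a'}Q(s',a')\bigr)$ with learning rate $\alpha\in(0,1)$. At each time $t$ the greedy policies $\boldsymbol{\pi}^{(n)}_t(s)=\operatorname{argmin}_{a'}\mathbf{Q}^{(n)}_t(s,a')$ are formed, the agreement rates $\frac1{|\mathcal{S}|}\sum_{j=1}^{|\mathcal{S}|}\mathbf{1}(\boldsymbol{\pi}^{(1)}_t(j)=\boldsymbol{\pi}^{(n)}_t(j))$, $n=1,\dots,K$, are computed, and the weight vector $(\mathbf{w}^{(1)}_t,\dots,\mathbf{w}^{(K)}_t)$ is the softmax of the vector of these rates. The output is updated by $\mathbf{Q}^{it}_{t+1}=u_t\mathbf{Q}^{it}_t+(1-u_t)\sum_{n=1}^K\mathbf{w}^{(n)}_t\mathbf{Q}^{(n)}_t$ with $\mathbf{Q}^{it}_0=\mathbf{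0}$.
   Formalization: The limit of |Δ_t| need not exist under a constant learning rate, so the bound is proved for the limsup, and for the limit whenever it exists; θ is the infimum of the positive bounds, which is 0 if ε is identically zero. *)

theory Defs
  imports "HOL-Probability.Probability"
begin

type_synonym ('s, 'a) qtable = "'s \<Rightarrow> 'a \<Rightarrow> real"

text \<open>A sample \<open>(s, a, s', c)\<close>: state, action, next state, incurred cost.\<close>

type_synonym ('s, 'a) sample = "'s \<times> 'a \<times> 's \<times> real"

text \<open>
  A Markov decision process is given by its transition kernel \<open>P s a\<close> and its cost function
  \<open>cost a s\<close>.  The statement is about each individual run of the algorithm, so of the law
  of the next state only the support matters.
\<close>

definition mdp_sample ::
    "('s \<Rightarrow> 'a \<Rightarrow> 's pmf) \<Rightarrow> ('a \<Rightarrow> 's \<Rightarrow> real) \<Rightarrow> ('s, 'a) sample \<Rightarrow> bool" where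
  "mdp_sample P cost = (\<lambda>(s, a, s', c). s' \<in> set_pmf (P s a) \<and> c = cost a s)"

definition q_update ::
    "real \<Rightarrow> real \<Rightarrow> ('s, 'a::finite) qtable \<Rightarrow> ('s, 'a) sample \<Rightarrow> ('s, 'a) qtable" where
  "q_update \<alpha> \<gamma> Q = (\<lambda>(s, a, s', c).
     Q(s := (Q s)(a := (1 - \<alpha>) * Q s a + \<alpha> * (c + \<gamma> * (MIN a'. Q s' a')))))"

text \<open>\<open>greedy Q \<pi>\<close> leaves the resolution of ties in the argmin arbitrary.\<close>

definition greedy :: "('s, 'a) qtable \<Rightarrow> ('s \<Rightarrow> 'a) \<Rightarrow> bool" where
  "greedy Q \<pi> \<longleftrightarrow> (\<forall>s. is_arg_min (Q s) (\<lambda>_. True) (\<pi> s))"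

definition agreement_rate :: "('s::finite \<Rightarrow> 'a) \<Rightarrow> ('s \<Rightarrow> 'a) \<Rightarrow> real" where
  "agreement_rate \<pi> \<pi>' = (\<Sum>j\<in>UNIV. of_bool (\<pi> j = \<pi>' j)) / real CARD('s)"

definition softmax :: "'i set \<Rightarrow> ('i \<Rightarrow> real) \<Rightarrow> 'i \<Rightarrow> real" where
  "softmax I x i = exp (x i) / (\<Sum>j\<in>I. exp (x j))"

text \<open>
  Environments are numbered \<open>1, \<dots>, K\<close>, environment 1 being the original one, and the first argument
  of \<open>\<pi>\<close>, \<open>Q\<close> and \<open>D\<close> below is the environment, the second the time.
\<close>

definition weight :: "nat \<Rightarrow> (nat \<Rightarrow> nat \<Rightarrow> 's::finite \<Rightarrow> 'a) \<Rightarrow> nat \<Rightarrow> nat \<Rightarrow> real" where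
  "weight K \<pi> n t = softmax {1..K} (\<lambda>m. agreement_rate (\<pi> 1 t) (\<pi> m t)) n"

text \<open>
  A run of the algorithm.  \<open>D n t\<close> is the finite sequence of samples of environment \<open>n\<close> processed
  between times \<open>t\<close> and \<open>t + 1\<close>; one sample per time step is the special case of lists of length 1.
  The kernels \<open>P n\<close> are arbitrary, however the synthetic environments were built from \<open>P 1\<close>, and so
  are the initial tables \<open>Q n 0\<close>.
\<close>

locale esql_run =
  fixes K :: nat
    and P :: "nat \<Rightarrow> 's::finite \<Rightarrow> 'a::finite \<Rightarrow> 's pmf"
    and cost :: "'a \<Rightarrow> 's \<Rightarrow> real"
    and \<gamma> \<alpha> :: real
    and u :: "nat \<Rightarrow> real"
    and D :: "nat \<Rightarrow> nat \<Rightarrow> ('s, 'a) sample list"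
    and Q :: "nat \<Rightarrow> nat \<Rightarrow> ('s, 'a) qtable"
    and \<pi> :: "nat \<Rightarrow> nat \<Rightarrow> 's \<Rightarrow> 'a"
    and Qit :: "nat \<Rightarrow> ('s, 'a) qtable"
  assumes K_pos: "1 \<le> K"
    and discount: "0 < \<gamma>" "\<gamma> < 1"
    and learning_rate: "0 < \<alpha>" "\<alpha> < 1"
    and samples: "\<And>n t x. n \<in> {1..K} \<Longrightarrow> x \<in> set (D n t) \<Longrightarrow> mdp_sample (P n) cost x"
    and Q_step: "\<And>n t. n \<in> {1..K} \<Longrightarrow> Q n (Suc t) = foldl (q_update \<alpha> \<gamma>) (Q n t) (D n t)"
    and policy: "\<And>n t. n \<in> {1..K} \<Longrightarrow> greedy (Q n t) (\<pi> n t)"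
    and Qit_0: "\<And>s a. Qit 0 s a = 0"
    and Qit_step: "\<And>t s a. Qit (Suc t) s a =
          u t * Qit t s a + (1 - u t) * (\<Sum>n=1..K. weight K \<pi> n t * Q n t s a)"

definition output_increment :: "(nat \<Rightarrow> ('s, 'a) qtable) \<Rightarrow> nat \<Rightarrow> 's \<Rightarrow> 'a \<Rightarrow> real" where
  "output_increment Qit t s a = Qit (Suc t) s a - Qit t s a"

definition weighted_update ::
    "nat \<Rightarrow> (nat \<Rightarrow> nat \<Rightarrow> 's::finite \<Rightarrow> 'a) \<Rightarrow> (nat \<Rightarrow> nat \<Rightarrow> ('s, 'a) qtable) \<Rightarrow>
     nat \<Rightarrow> nat \<Rightarrow> 's \<Rightarrow> 'a \<Rightarrow> real" where
  "weighted_update K \<pi> Q n t s a =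
     weight K \<pi> n (Suc t) * Q n (Suc t) s a - weight K \<pi> n t * Q n t s a"

text \<open>
  The smallest positive bound on the absolute value of a real sequence.  For the zero sequence
  there is no smallest positive bound; the infimum then is 0, the only sensible value.  In every
  other bounded case the infimum is attained, see the two lemmas below.
\<close>

definition smallest_positive_bound :: "(nat \<Rightarrow> real) \<Rightarrow> real" where
  "smallest_positive_bound x = Inf {b. 0 < b \<and> (\<forall>t. \<bar>x t\<bar> \<le> b)}"

lemma smallest_positive_bound_eqI:
  assumes "0 < b" "\<And>t. \<bar>x t\<bar> \<le> b"
    and "\<And>b'. 0 < b' \<Longrightarrow> (\<And>t. \<bar>x t\<bar> \<le> b') \<Longrightarrow> b \<le> b'"
  shows "smallest_positive_bound x = b"
  unfolding smallest_positive_bound_def using assms by (intro cInf_eq_minimum) auto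

lemma smallest_positive_bound_attained:
  assumes bdd: "\<And>t. \<bar>x t\<bar> \<le> B" and nz: "x t0 \<noteq> 0"
  shows "0 < smallest_positive_bound x" and "\<bar>x t\<bar> \<le> smallest_positive_bound x"
proof -
  have B: "0 < B" using bdd[of t0] nz by linarith
  have ne: "{b. 0 < b \<and> (\<forall>t. \<bar>x t\<bar> \<le> b)} \<noteq> {}" using B bdd by blast
  have le: "\<bar>x i\<bar> \<le> smallest_positive_bound x" for i
    unfolding smallest_positive_bound_def by (rule cInf_greatest[OF ne]) blast
  show "\<bar>x t\<bar> \<le> smallest_positive_bound x" by (rule le)
  show "0 < smallest_positive_bound x" using le[of t0] nz by linarith
qed

end

theory Submission imports Defs begin

text \<open>
  The output increment satisfies the recursion
  \<open>\<Delta>\<^sub>t\<^sub>+\<^sub>1 = u \<Delta>\<^sub>t + (1 - u) (\<Sum>n. \<epsilon> n t)\<close>, hence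
  \<open>\<bar>\<Delta>\<^sub>t\<bar> \<le> u ^ t \<bar>\<Delta>\<^sub>0\<bar> + (\<Sum>n. \<theta> n)\<close>.  For \<open>\<theta> n\<close> to be a bound at all, the sequence
  \<open>\<epsilon> n\<close> must be bounded: every box \<open>\<bar>Q s a\<bar> \<le> B\<close> with \<open>\<bar>cost\<bar> \<le> (1 - \<gamma>) B\<close> is invariant under
  the Q-learning update, and the softmax weights lie between 0 and 1.
\<close>

lemma abs_Min_range_le:
  fixes f :: "'a::finite \<Rightarrow> real"
  assumes "\<And>a. \<bar>f a\<bar> \<le> B"
  shows "\<bar>MIN a. f a\<bar> \<le> B"
proof -
  have "(MIN a. f a) \<in> range f" by (rule Min_in) auto
  then obtain a where "(MIN a. f a) = f a" by blast
  then show ?thesis using assms[of a] by simp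
qed

text \<open>The target is at most \<open>(1 - \<gamma>) * B + \<gamma> * B = B\<close> in absolute
  value, and the new entry is a convex combination of the old entry and the target.\<close>

lemma q_update_bounded:
  fixes Q :: "('s, 'a::finite) qtable"
  assumes \<alpha>: "0 < \<alpha>" "\<alpha> < 1" and \<gamma>: "0 < \<gamma>" "\<gamma> < 1"
    and c: "\<bar>c\<bar> \<le> (1 - \<gamma>) * B" and Q: "\<And>s a. \<bar>Q s a\<bar> \<le> B"
  shows "\<bar>q_update \<alpha> \<gamma> Q (s, a, s', c) s0 a0\<bar> \<le> B"
proof -
  let ?m = "MIN a'. Q s' a'"
  have "\<bar>c + \<gamma> * ?m\<bar> \<le> \<bar>c\<bar> + \<gamma> * \<bar>?m\<bar>"
    using \<gamma> abs_triangle_ineq[of c "\<gamma> * ?m"] by (simp add: abs_mult)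
  also have "\<dots> \<le> (1 - \<gamma>) * B + \<gamma> * B"
    using c \<gamma> Q by (intro add_mono mult_left_mono abs_Min_range_le) auto
  finally have target: "\<bar>c + \<gamma> * ?m\<bar> \<le> B" by (simp add: algebra_simps)
  have "\<bar>(1 - \<alpha>) * Q s a + \<alpha> * (c + \<gamma> * ?m)\<bar> \<le> (1 - \<alpha>) * \<bar>Q s a\<bar> + \<alpha> * \<bar>c + \<gamma> * ?m\<bar>"
    using \<alpha> abs_triangle_ineq[of "(1 - \<alpha>) * Q s a" "\<alpha> * (c + \<gamma> * ?m)"] by (simp add: abs_mult)
  also have "\<dots> \<le> (1 - \<alpha>) * B + \<alpha> * B"
    using \<alpha> Q target by (intro add_mono mult_left_mono) auto
  finally have "\<bar>(1 - \<alpha>) * Q s a + \<alpha> * (c + \<gamma> * ?m)\<bar> \<le> B" by (simp add: algebra_simps)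
  then show ?thesis using Q by (simp add: q_update_def)
qed

lemma foldl_q_update_bounded:
  fixes Q :: "('s, 'a::finite) qtable"
  assumes "0 < \<alpha>" "\<alpha> < 1" "0 < \<gamma>" "\<gamma> < 1"
    and "\<And>s a s' c. (s, a, s', c) \<in> set xs \<Longrightarrow> \<bar>c\<bar> \<le> (1 - \<gamma>) * B"
    and "\<And>s a. \<bar>Q s a\<bar> \<le> B"
  shows "\<bar>foldl (q_update \<alpha> \<gamma>) Q xs s a\<bar> \<le> B"
  using assms(5,6)
proof (induction xs arbitrary: Q)
  case (Cons x xs)
  obtain s1 a1 s' c where x: "x = (s1, a1, s', c)" by (cases x)
  have "\<bar>c\<bar> \<le> (1 - \<gamma>) * B" using Cons.prems(1)[of s1 a1 s' c] x by simp
  then have "\<bar>q_update \<alpha> \<gamma> Q x s0 a0\<bar> \<le> B" for s0 a0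
    unfolding x using assms(1-4) Cons.prems(2) by (intro q_update_bounded) auto
  then show ?case unfolding foldl_Cons
    by (intro Cons.IH Cons.prems(1)[OF list.set_intros(2)])
qed simp

lemma softmax_bounds:
  assumes "finite I" "i \<in> I"
  shows "0 \<le> softmax I x i" and "softmax I x i \<le> 1"
proof -
  have "exp (x i) \<le> (\<Sum>j\<in>I. exp (x j))" using assms by (intro member_le_sum) auto
  moreover from this have "0 < (\<Sum>j\<in>I. exp (x j))" by (rule less_le_trans[OF exp_gt_zero])
  ultimately show "0 \<le> softmax I x i" "softmax I x i \<le> 1"
    unfolding softmax_def by (auto simp: divide_le_eq_1 intro!: divide_nonneg_pos)
qed

lemma smallest_positive_bound_nonneg:
  assumes "\<And>t. \<bar>x t\<bar> \<le> B"
  shows "0 \<le> smallest_positive_bound x"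
proof -
  \<comment> \<open>\<open>B\<close> itself may be 0, for the zero sequence, and then fails the
    strict positivity; \<open>max B 1\<close> shows that the infimum is over a nonempty set.\<close>
  have "max B 1 \<in> {b. 0 < b \<and> (\<forall>t. \<bar>x t\<bar> \<le> b)}"
    using assms by (auto simp: le_max_iff_disj)
  then show ?thesis
    unfolding smallest_positive_bound_def by (intro cInf_greatest) auto
qed

text \<open>If \<open>x t\<close> is nonzero, it serves as the witness that the infimum is attained.
  If it is zero, nonnegativity of the infimum is enough; this covers the zero sequence.\<close>

lemma le_smallest_positive_bound:
  assumes "\<And>t. \<bar>x t\<bar> \<le> B"
  shows "\<bar>x t\<bar> \<le> smallest_positive_bound x"
  using smallest_positive_bound_attained(2)[of x B t t, OF assms]
    smallest_positive_bound_nonneg[of x B, OF assms]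
  by (cases "x t = 0") auto

text \<open>\<open>S\<close> is the fixed point of the map taking \<open>b\<close> to
  \<open>u * b + (1 - u) * S\<close>, so only the contribution of \<open>d 0\<close> is carried
  along, shrinking by the factor \<open>u\<close> at each step.\<close>

lemma relaxation_bound:
  fixes d e :: "nat \<Rightarrow> real"
  assumes "0 < u" "u < 1" and "\<And>t. d (Suc t) = u * d t + (1 - u) * e t"
    and "\<And>t. \<bar>e t\<bar> \<le> S"
  shows "\<bar>d t\<bar> \<le> u ^ t * \<bar>d 0\<bar> + S"
proof (induction t)
  case 0
  \<comment> \<open>The bound on \<open>e 0\<close> is what yields \<open>0 \<le> S\<close>.\<close>
  show ?case using assms(4)[of 0] by simp
next
  case (Suc t)
  have "\<bar>d (Suc t)\<bar> \<le> u * \<bar>d t\<bar> + (1 - u) * \<bar>e t\<bar>"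
    using assms(1,2) abs_triangle_ineq[of "u * d t" "(1 - u) * e t"]
    by (simp add: assms(3) abs_mult)
  also have "\<dots> \<le> u * (u ^ t * \<bar>d 0\<bar> + S) + (1 - u) * S"
    using assms Suc by (intro add_mono mult_left_mono) auto
  finally show ?case by (simp add: algebra_simps)
qed

text \<open>Convergence of \<open>x\<close> is not assumed, hence a limsup, taken in
  \<open>ereal\<close>, where it always exists. It serves for output increments that are not known
  to converge.\<close>

lemma limsup_le_lim:
  fixes x y :: "nat \<Rightarrow> real"
  assumes "\<And>t. x t \<le> y t" and "y \<longlonglongrightarrow> S"
  shows "limsup (\<lambda>t. ereal (x t)) \<le> ereal S"
proof -
  have "limsup (\<lambda>t. ereal (x t)) \<le> limsup (\<lambda>t. ereal (y t))"
    using assms(1) by (intro Limsup_mono) auto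
  also have "\<dots> = ereal S"
    using assms(2) by (intro lim_imp_Limsup) auto
  finally show ?thesis .
qed

context esql_run
begin

lemma Q_bounded: "\<exists>B. \<forall>n\<in>{1..K}. \<forall>t s a. \<bar>Q n t s a\<bar> \<le> B"
proof -
  \<comment> \<open>Sums over the finite index sets replace maxima. \<open>B\<close> has to dominate
    every initial entry, through \<open>M\<close>, and satisfy
    \<open>C \<le> (1 - \<gamma>) * B\<close>, so that the box is invariant under each
    update.\<close>
  define C where "C = (\<Sum>a\<in>UNIV. \<Sum>s\<in>UNIV. \<bar>cost a s\<bar>)"
  define M where "M = (\<Sum>n\<in>{1..K}. \<Sum>s\<in>UNIV. \<Sum>a\<in>UNIV. \<bar>Q n 0 s a\<bar>)"
  define B where "B = max M (C / (1 - \<gamma>))"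
  have cost: "\<bar>cost a s\<bar> \<le> (1 - \<gamma>) * B" for a s
  proof -
    have "\<bar>cost a s\<bar> \<le> (\<Sum>s\<in>UNIV. \<bar>cost a s\<bar>)" by (intro member_le_sum) auto
    also have "\<dots> \<le> C" unfolding C_def
      by (intro member_le_sum[of a UNIV "\<lambda>a. \<Sum>s\<in>UNIV. \<bar>cost a s\<bar>"]) (auto intro: sum_nonneg)
    also have "C = (1 - \<gamma>) * (C / (1 - \<gamma>))" using discount by simp
    also have "\<dots> \<le> (1 - \<gamma>) * B" using discount unfolding B_def by (intro mult_left_mono) auto
    finally show ?thesis .
  qed
  have init: "\<bar>Q n 0 s a\<bar> \<le> B" if "n \<in> {1..K}" for n s a
  proof -
    have "\<bar>Q n 0 s a\<bar> \<le> (\<Sum>a\<in>UNIV. \<bar>Q n 0 s a\<bar>)" by (intro member_le_sum) auto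
    also have "\<dots> \<le> (\<Sum>s\<in>UNIV. \<Sum>a\<in>UNIV. \<bar>Q n 0 s a\<bar>)"
      by (intro member_le_sum[of s UNIV "\<lambda>s. \<Sum>a\<in>UNIV. \<bar>Q n 0 s a\<bar>"]) (auto intro: sum_nonneg)
    also have "\<dots> \<le> M" unfolding M_def using that
      by (intro member_le_sum[of n _ "\<lambda>n. \<Sum>s\<in>UNIV. \<Sum>a\<in>UNIV. \<bar>Q n 0 s a\<bar>"])
        (auto intro!: sum_nonneg)
    finally show ?thesis unfolding B_def by simp
  qed
  have "\<bar>Q n t s a\<bar> \<le> B" if n: "n \<in> {1..K}" for n t s a
  proof (induction t arbitrary: s a)
    case 0
    show ?case by (rule init[OF n])
  next
    case (Suc t)
    \<comment> \<open>The cost in a sample is the value of \<open>cost\<close> at its state and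
      action, so the bound on \<open>cost\<close> applies to the whole list.\<close>
    have "\<bar>c\<bar> \<le> (1 - \<gamma>) * B" if "(s1, a1, s', c) \<in> set (D n t)" for s1 a1 s' c
      using samples[OF n that] cost by (simp add: mdp_sample_def)
    then show ?case
      unfolding Q_step[OF n] using Suc learning_rate discount by (intro foldl_q_update_bounded) auto
  qed
  then show ?thesis by blast
qed

text \<open>Weights in the unit interval keep each weighted table within the box, and a difference
  of two such entries is at most \<open>2 * B\<close>.\<close>

lemma weighted_update_bounded:
  "\<exists>B. \<forall>n\<in>{1..K}. \<forall>t s a. \<bar>weighted_update K \<pi> Q n t s a\<bar> \<le> B"
proof -
  obtain B where B: "\<And>n t s a. n \<in> {1..K} \<Longrightarrow> \<bar>Q n t s a\<bar> \<le> B" using Q_bounded by blast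
  have wQ: "\<bar>weight K \<pi> n t * Q n t s a\<bar> \<le> B" if n: "n \<in> {1..K}" for n t s a
  proof -
    have w: "0 \<le> weight K \<pi> n t" "weight K \<pi> n t \<le> 1"
      unfolding weight_def by (intro softmax_bounds finite_atLeastAtMost n)+
    then have "\<bar>weight K \<pi> n t * Q n t s a\<bar> \<le> 1 * \<bar>Q n t s a\<bar>"
      unfolding abs_mult by (intro mult_right_mono) auto
    then show ?thesis using B[OF n, of t s a] by linarith
  qed
  have "\<bar>weighted_update K \<pi> Q n t s a\<bar> \<le> 2 * B" if n: "n \<in> {1..K}" for n t s a
    using wQ[OF n, of t s a] wQ[OF n, of "Suc t" s a] unfolding weighted_update_def by linarith
  then show ?thesis by blast
qed

text \<open>Two consecutive output updates are subtracted. The constant ratio matters: a varying one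
  would leave an extra term proportional to \<open>u (Suc t) - u t\<close>.\<close>

lemma output_increment_Suc:
  assumes "\<And>t. u t = v"
  shows "output_increment Qit (Suc t) s a = v * output_increment Qit t s a
    + (1 - v) * (\<Sum>n=1..K. weighted_update K \<pi> Q n t s a)"
proof -
  let ?W = "\<lambda>t. \<Sum>n=1..K. weight K \<pi> n t * Q n t s a"
  have step: "Qit (Suc t) s a = v * Qit t s a + (1 - v) * ?W t" for t
    using Qit_step[of t s a] unfolding assms .
  have "(\<Sum>n=1..K. weighted_update K \<pi> Q n t s a) = ?W (Suc t) - ?W t"
    unfolding weighted_update_def by (rule sum_subtractf)
  then show ?thesis
    unfolding output_increment_def step[of "Suc t"] using step[of t] by algebra
qed

end

theorem proposition2:
  fixes K :: nat
    and P :: "nat \<Rightarrow> 's::finite \<Rightarrow> 'a::finite \<Rightarrow> 's pmf"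
    and cost :: "'a \<Rightarrow> 's \<Rightarrow> real"
    and \<gamma> \<alpha> u :: real
    and D :: "nat \<Rightarrow> nat \<Rightarrow> ('s, 'a) sample list"
    and Q :: "nat \<Rightarrow> nat \<Rightarrow> ('s, 'a) qtable"
    and \<pi> :: "nat \<Rightarrow> nat \<Rightarrow> 's \<Rightarrow> 'a"
    and Qit :: "nat \<Rightarrow> ('s, 'a) qtable"
    and \<Delta>it :: "nat \<Rightarrow> 's \<Rightarrow> 'a \<Rightarrow> real"
    and \<epsilon> :: "nat \<Rightarrow> nat \<Rightarrow> 's \<Rightarrow> 'a \<Rightarrow> real"
    and \<theta> :: "nat \<Rightarrow> 's \<Rightarrow> 'a \<Rightarrow> real"
  defines "\<Delta>it \<equiv> output_increment Qit"
    and "\<epsilon> \<equiv> weighted_update K \<pi> Q"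
    and "\<theta> \<equiv> \<lambda>n s a. smallest_positive_bound (\<lambda>t. \<epsilon> n t s a)"
  assumes "esql_run K P cost \<gamma> \<alpha> (\<lambda>_. u) D Q \<pi> Qit"
    and "0 < u" and "u < 1"
  shows "\<forall>s a. limsup (\<lambda>t. ereal \<bar>\<Delta>it t s a\<bar>) \<le> ereal (\<Sum>n=1..K. \<theta> n s a)
      \<and> (convergent (\<lambda>t. \<bar>\<Delta>it t s a\<bar>) \<longrightarrow> lim (\<lambda>t. \<bar>\<Delta>it t s a\<bar>) \<le> (\<Sum>n=1..K. \<theta> n s a))"
proof (intro allI)
  fix s a
  interpret esql_run K P cost \<gamma> \<alpha> "\<lambda>_. u" D Q \<pi> Qit by fact
  let ?S = "\<Sum>n=1..K. \<theta> n s a"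
  let ?bound = "\<lambda>t. u ^ t * \<bar>\<Delta>it 0 s a\<bar> + ?S"
  \<comment> \<open>Without a finite bound, \<open>\<theta>\<close> would be the infimum of an empty
    set and would not dominate \<open>\<epsilon>\<close>.\<close>
  obtain B where B: "\<And>n t s a. n \<in> {1..K} \<Longrightarrow> \<bar>\<epsilon> n t s a\<bar> \<le> B"
    using weighted_update_bounded unfolding \<epsilon>_def by blast
  have \<epsilon>_le: "\<bar>\<epsilon> n t s a\<bar> \<le> \<theta> n s a" if "n \<in> {1..K}" for n t
    unfolding \<theta>_def by (rule le_smallest_positive_bound) (rule B[OF that])
  have "\<bar>\<Sum>n=1..K. \<epsilon> n t s a\<bar> \<le> ?S" for t
    using sum_abs[of "\<lambda>n. \<epsilon> n t s a" "{1..K}"] sum_mono[of "{1..K}", OF \<epsilon>_le]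
    by (rule order_trans)
  moreover have "\<Delta>it (Suc t) s a = u * \<Delta>it t s a + (1 - u) * (\<Sum>n=1..K. \<epsilon> n t s a)" for t
    unfolding \<Delta>it_def \<epsilon>_def by (rule output_increment_Suc) simp
  ultimately have le: "\<bar>\<Delta>it t s a\<bar> \<le> ?bound t" for t
    by (intro relaxation_bound[OF \<open>0 < u\<close> \<open>u < 1\<close>, where d = "\<lambda>t. \<Delta>it t s a"])
  have lim: "?bound \<longlonglongrightarrow> ?S"
    using \<open>0 < u\<close> \<open>u < 1\<close> by (auto intro!: tendsto_eq_intros LIMSEQ_realpow_zero)
  \<comment> \<open>If the limit exists, the pointwise bound \<open>le\<close> passes to the limit
    on both sides.\<close>
  have "lim (\<lambda>t. \<bar>\<Delta>it t s a\<bar>) \<le> ?S" if "convergent (\<lambda>t. \<bar>\<Delta>it t s a\<bar>)"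
    using that lim le by (intro LIMSEQ_le[of "\<lambda>t. \<bar>\<Delta>it t s a\<bar>" _ ?bound])
      (auto simp: convergent_LIMSEQ_iff)
  then show "limsup (\<lambda>t. ereal \<bar>\<Delta>it t s a\<bar>) \<le> ereal ?S
      \<and> (convergent (\<lambda>t. \<bar>\<Delta>it t s a\<bar>) \<longrightarrow> lim (\<lambda>t. \<bar>\<Delta>it t s a\<bar>) \<le> ?S)"
    using limsup_le_lim[OF le lim] by blast
qed

end
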